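(* For each $N\in\mathbb N$ let $w=w_N$ be a strictly positive even weight on $\mathfrak X=\{-N,\dots,N\}$, with associated kernels $\mathbb K_k$ and $\mathfrak K_n^{(d)}$ as in the context. Let $N\to\infty$, and let $n=n(N)$ be a sequence of positive integers such that $n\to\infty$ and $N-n\to\infty$. Let $v\in[-1,1]\setminus\{0\}$, let $\mathbb X\in\{\mathbb Z,\mathbb Z_{\ge0},\mathbb Z_{\le0},\mathbb R\}$, and let $\{D_N\}$ be a positive sequence. Suppose that there is a sequence of maps $x_N:\mathbb X\to\mathfrak X=\{-N,\dots,N\}$ such that, for every fixed $A\in\mathbb X$, $x_N(A)/N\to v$. Suppose that there exists a kernel $\mathbb K_{\lim}$ on $\mathbb X^2$ such that, for every fixed $j\in\mathbb Z$ and all fixed $A,B\in\mathbb X$, $$\lim_{N\to\infty}D_N\,\mathbb K_{2n+j}\bigl(x_N(A),x_N(B)\bigr)=\mathbb K_{\lim}(A,B).$$ Then, for every fixed $d\in\mathbb Z_{\ge0}$ and all $A,B\in\mathbb X$, $$\lim_{N\to\infty}D_N\,\mathfrak K^{(d)}_n\bigl(x_N(A),x_N(B)\bigr)=\mathbb K_{\lim}(A,B).$$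
   Context: Fix $N$ and a strictly positive even weight $w$ on $\mathfrak X=\{-N,\dots,N\}$. $P_m$ ($0\le m\le 2N$) are the monic orthogonal polynomials with $\sum_{x\in\mathfrak X}P_m(x)P_\ell(x)w(x)=\delta_{m\ell}h_m^2$, $h_m>0$, and $p_m(x)=P_m(x)\sqrt{w(x)}/h_m$. The Christoffel--Darboux kernel is $\mathbb K_k(x,y)=\sum_{i=0}^{k-1}p_i(x)p_i(y)$. For $d\ge1$, $P^{(d)}_m$ ($0\le m\le 2N-1$) are the monic orthogonal polynomials on $\mathfrak X$ with respect to the weight $x^{2d}w(x)$, and $$p^{(d)}_m(x)=\frac{P^{(d)}_m(x)}{\|P_m^{(d)}\|_{x^{2d}w(x)}}\,x^d\sqrt{w(x)},\qquad \|f\|_{x^{2d}w(x)}^2=\sum_{x\in\mathfrak X}f(x)^2x^{2d}w(x).$$ Put $\eta(x)=1$ for $x\neq0$, $\eta(0)=1/\sqrt2$. For $x,y\in\mathfrak X$, $$\mathfrak K^{(0)}_n(x,y)=2\eta(x)\eta(y)\sum_{\ell=0}^{n-1}p_{2\ell}(x)p_{2\ell}(y),\qquad \mathfrak K^{(d)}_n(x,y)=2\sum_{\ell=0}^{n-1}p^{(d)}_{2\ell}(x)p^{(d)}_{2\ell}(y)\quad(d\ge1).$$ *)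

theory Defs
  imports Complex_Main "HOL-Computational_Algebra.Polynomial"
begin

definition grid :: "nat \<Rightarrow> int set" where
  "grid N = {- int N..int N}"

text \<open>Inner product and norm of (the restrictions to the grid of) real polynomials with respect
  to a weight \<open>W\<close>.\<close>

definition winner :: "nat \<Rightarrow> (int \<Rightarrow> real) \<Rightarrow> real poly \<Rightarrow> real poly \<Rightarrow> real" where
  "winner N W f g = (\<Sum>x\<in>grid N. poly f (of_int x) * poly g (of_int x) * W x)"

definition wnorm :: "nat \<Rightarrow> (int \<Rightarrow> real) \<Rightarrow> real poly \<Rightarrow> real" where
  "wnorm N W f = sqrt (\<Sum>x\<in>grid N. (poly f (of_int x))\<^sup>2 * W x)"

text \<open>\<open>P 0, \<dots>, P (M - 1)\<close> are the monic orthogonal polynomials for the weight \<open>W\<close>. They exist and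
  are unique when \<open>W\<close> is nonnegative and positive at \<open>M\<close> or more points of the grid; the values of \<open>P\<close>
  at indices \<open>\<ge> M\<close> are left unspecified. The squared norm \<open>h\<^sub>m\<^sup>2\<close> is \<open>winner N W (P m) (P m)\<close>, so
  \<open>h\<^sub>m\<close> is \<open>wnorm N W (P m)\<close>.\<close>

definition monic_orthogonal :: "nat \<Rightarrow> (int \<Rightarrow> real) \<Rightarrow> nat \<Rightarrow> (nat \<Rightarrow> real poly) \<Rightarrow> bool" where
  "monic_orthogonal N W M P \<longleftrightarrow>
     (\<forall>m<M. degree (P m) = m \<and> lead_coeff (P m) = 1) \<and>
     (\<forall>m<M. \<forall>l<M. m \<noteq> l \<longrightarrow> winner N W (P m) (P l) = 0)"

definition even_positive_weight :: "nat \<Rightarrow> (int \<Rightarrow> real) \<Rightarrow> bool" where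
  "even_positive_weight N w \<longleftrightarrow> (\<forall>x\<in>grid N. w x > 0 \<and> w (- x) = w x)"

definition deformed_weight :: "(int \<Rightarrow> real) \<Rightarrow> nat \<Rightarrow> int \<Rightarrow> real" where
  "deformed_weight w d x = of_int x ^ (2 * d) * w x"

definition ortho_fun :: "nat \<Rightarrow> (int \<Rightarrow> real) \<Rightarrow> (nat \<Rightarrow> real poly) \<Rightarrow> nat \<Rightarrow> int \<Rightarrow> real" where
  "ortho_fun N w P m x = poly (P m) (of_int x) * sqrt (w x) / wnorm N w (P m)"

definition deformed_ortho_fun ::
    "nat \<Rightarrow> (int \<Rightarrow> real) \<Rightarrow> nat \<Rightarrow> (nat \<Rightarrow> real poly) \<Rightarrow> nat \<Rightarrow> int \<Rightarrow> real" where
  "deformed_ortho_fun N w d Q m x =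
     poly (Q m) (of_int x) / wnorm N (deformed_weight w d) (Q m) * of_int x ^ d * sqrt (w x)"

definition CD_kernel ::
    "nat \<Rightarrow> (int \<Rightarrow> real) \<Rightarrow> (nat \<Rightarrow> real poly) \<Rightarrow> nat \<Rightarrow> int \<Rightarrow> int \<Rightarrow> real" where
  "CD_kernel N w P k x y = (\<Sum>i<k. ortho_fun N w P i x * ortho_fun N w P i y)"

definition eta :: "int \<Rightarrow> real" where
  "eta x = (if x = 0 then 1 / sqrt 2 else 1)"

text \<open>\<open>P\<close> is the monic orthogonal family for \<open>w\<close>, and \<open>Q d\<close> (used for \<open>d \<ge> 1\<close> only) the one for
  \<open>x\<^sup>2\<^sup>d w(x)\<close>.\<close>

definition even_kernel ::
    "nat \<Rightarrow> (int \<Rightarrow> real) \<Rightarrow> (nat \<Rightarrow> real poly) \<Rightarrow> (nat \<Rightarrow> nat \<Rightarrow> real poly)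
      \<Rightarrow> nat \<Rightarrow> nat \<Rightarrow> int \<Rightarrow> int \<Rightarrow> real" where
  "even_kernel N w P Q d n x y =
     (if d = 0
      then 2 * eta x * eta y * (\<Sum>l<n. ortho_fun N w P (2 * l) x * ortho_fun N w P (2 * l) y)
      else 2 * (\<Sum>l<n. deformed_ortho_fun N w d (Q d) (2 * l) x *
                        deformed_ortho_fun N w d (Q d) (2 * l) y))"

end

theory Submission
  imports Defs "HOL-Analysis.Convex"
begin

text \<open>
  Why the theorem holds. Let \<open>V k\<close> be the space of functions \<open>r \<surd>w\<close> on the grid with \<open>r\<close> a
  polynomial of degree less than \<open>k\<close>, and \<open>K\<^sub>k\<close> its reproducing kernel, the Christoffel--Darboux
  kernel. The functions \<open>p\<^sup>d\<^sub>i\<close> with \<open>i < k\<close> span \<open>x\<^sup>d V k\<close>, a subspace of \<open>V (k + d)\<close>; let \<open>L\<^sub>k\<close> be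
  its reproducing kernel. Since \<open>p\<^sup>d\<^sub>i\<close> has parity \<open>(-1)\<^sup>i\<^sup>+\<^sup>d\<close>, keeping only the even indices below
  \<open>2n\<close> and doubling amounts to forming \<open>L\<^sub>2\<^sub>n(x, y) + (-1)\<^sup>d L\<^sub>2\<^sub>n(x, -y)\<close>. Put \<open>k = 2n + d\<close>. As
  \<open>D K\<^sub>k(x, y)\<close> converges to the right limit by hypothesis, it suffices that \<open>D\<close> times each of
  \<open>K\<^sub>k(x, -y)\<close> and \<open>(K\<^sub>k - L\<^sub>2\<^sub>n)(x, \<plusminus>y)\<close> tends to zero.

  Both follow from one observation (\<open>tail_bound\<close>): if \<open>h\<close> in \<open>V l\<close> is orthogonal to
  \<open>p\<^sub>0, \<dots>, p\<^sub>m\<^sub>-\<^sub>1\<close>, then Parseval and Cauchy--Schwarz bound \<open>h(z)\<^sup>2\<close> by \<open>\<parallel>h\<parallel>\<^sup>2\<close> times the sum of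
  \<open>p\<^sub>i(z)\<^sup>2\<close> over \<open>m \<le> i < l\<close>. When \<open>m\<close> and \<open>l\<close> differ from \<open>2n\<close> by constants, \<open>D\<close> times this sum is a
  difference of two diagonal kernels with the same limit, so it vanishes. The observation is applied
  to two functions of \<open>z\<close>.

  \<^item> \<open>(x - z) K\<^sub>k(x, z)\<close> is orthogonal to \<open>V (k - 1)\<close>: pairing it with \<open>f\<close> evaluates
    \<open>(x - z) f(z)\<close> at \<open>z = x\<close>. At \<open>z = -y\<close> the factor is \<open>x + y\<close>, of order \<open>2vN\<close> with \<open>v \<noteq> 0\<close>.
  \<^item> \<open>z\<^sup>d (K\<^sub>k - L\<^sub>2\<^sub>n)(x, z)\<close> is orthogonal to \<open>V (2n)\<close>, because \<open>K\<^sub>k - L\<^sub>2\<^sub>n\<close> is orthogonal to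
    \<open>z\<^sup>d V (2n)\<close>. At \<open>z = \<plusminus>y\<close> the factor has modulus of order \<open>(\<bar>v\<bar>N)\<^sup>d\<close>.

  Multiplication by \<open>x - z\<close> or \<open>z\<^sup>d\<close> costs at most a factor \<open>2N\<close> or \<open>N\<^sup>d\<close> in norm, which the two
  factors above compensate, and the remaining squared norms are at most \<open>K\<^sub>k(x, x)\<close>, which is bounded
  after multiplication by \<open>D\<close>.
\<close>

section \<open>Weighted polynomials on a finite set\<close>

definition dot :: "int set \<Rightarrow> (int \<Rightarrow> real) \<Rightarrow> (int \<Rightarrow> real) \<Rightarrow> real" where
  "dot S f g = (\<Sum>x\<in>S. f x * g x)"

text \<open>Membership constrains only the values on \<open>S\<close>, since a weight may be arbitrary outside the
  grid. Bounding the degree through vanishing coefficients makes the case \<open>k = 0\<close> the zero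
  space.\<close>

definition poly_space :: "int set \<Rightarrow> (int \<Rightarrow> real) \<Rightarrow> nat \<Rightarrow> (int \<Rightarrow> real) set" where
  "poly_space S u k = {f. \<exists>p. (\<forall>i\<ge>k. coeff p i = 0) \<and> (\<forall>x\<in>S. f x = poly p (of_int x) * u x)}"

text \<open>For orthonormal \<open>p 0, \<dots>, p (k - 1)\<close> this is the reproducing kernel of their span.\<close>

definition sum_kernel :: "(nat \<Rightarrow> int \<Rightarrow> real) \<Rightarrow> nat \<Rightarrow> int \<Rightarrow> int \<Rightarrow> real" where
  "sum_kernel p k x y = (\<Sum>i<k. p i x * p i y)"

lemma dot_commute: "dot S f g = dot S g f"
  by (simp add: dot_def mult.commute)

lemma dot_diff_left: "dot S (\<lambda>x. f x - g x) h = dot S f h - dot S g h"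
  by (simp add: dot_def algebra_simps sum_subtractf)

lemma dot_scale_left: "dot S (\<lambda>x. c * f x) h = c * dot S f h"
  by (simp add: dot_def sum_distrib_left mult.assoc)

lemma dot_sum_left: "dot S (\<lambda>x. \<Sum>i\<in>I. c i * f i x) h = (\<Sum>i\<in>I. c i * dot S (f i) h)"
  unfolding dot_def sum_distrib_right sum_distrib_left
  by (subst sum.swap) (simp add: mult.assoc)

lemma dot_cong: "(\<And>x. x \<in> S \<Longrightarrow> f x = f' x) \<Longrightarrow> (\<And>x. x \<in> S \<Longrightarrow> g x = g' x) \<Longrightarrow> dot S f g = dot S f' g'"
  by (simp add: dot_def)

lemma dot_self_eq_0D: "finite S \<Longrightarrow> dot S f f = 0 \<Longrightarrow> x \<in> S \<Longrightarrow> f x = 0"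
  by (auto simp: dot_def sum_nonneg_eq_0_iff)

lemma dot_mult_left: "dot S (\<lambda>x. t x * f x) g = dot S f (\<lambda>x. t x * g x)"
  by (simp add: dot_def mult_ac)

lemma dot_mult_self_le:
  assumes "\<And>x. x \<in> S \<Longrightarrow> \<bar>t x\<bar> \<le> C"
  shows "dot S (\<lambda>x. t x * f x) (\<lambda>x. t x * f x) \<le> C\<^sup>2 * dot S f f"
  unfolding dot_def sum_distrib_left
proof (rule sum_mono)
  fix x assume "x \<in> S"
  then have "(t x)\<^sup>2 \<le> C\<^sup>2"
    using assms[of x] by (metis abs_ge_zero abs_of_nonneg order_trans abs_le_square_iff)
  then have "(t x)\<^sup>2 * (f x)\<^sup>2 \<le> C\<^sup>2 * (f x)\<^sup>2"
    by (rule mult_right_mono) simp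
  then show "t x * f x * (t x * f x) \<le> C\<^sup>2 * (f x * f x)"
    by (simp add: power2_eq_square mult_ac)
qed

lemma poly_space_diff:
  assumes "f \<in> poly_space S u k" "g \<in> poly_space S u k"
  shows "(\<lambda>x. f x - g x) \<in> poly_space S u k"
proof -
  obtain p q where "\<forall>i\<ge>k. coeff p i = 0" "\<forall>x\<in>S. f x = poly p (of_int x) * u x"
    "\<forall>i\<ge>k. coeff q i = 0" "\<forall>x\<in>S. g x = poly q (of_int x) * u x"
    using assms by (auto simp: poly_space_def)
  then show ?thesis
    unfolding poly_space_def by (auto intro!: exI[of _ "p - q"] simp: algebra_simps)
qed

lemma poly_space_scale:
  assumes "f \<in> poly_space S u k"
  shows "(\<lambda>x. c * f x) \<in> poly_space S u k"
proof -
  obtain p where "\<forall>i\<ge>k. coeff p i = 0" "\<forall>x\<in>S. f x = poly p (of_int x) * u x"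
    using assms by (auto simp: poly_space_def)
  then show ?thesis
    unfolding poly_space_def by (auto intro!: exI[of _ "smult c p"])
qed

lemma poly_space_sum:
  assumes "\<And>i. i \<in> I \<Longrightarrow> f i \<in> poly_space S u k"
  shows "(\<lambda>x. \<Sum>i\<in>I. f i x) \<in> poly_space S u k"
proof -
  obtain p where p: "\<And>i. i \<in> I \<Longrightarrow> (\<forall>j\<ge>k. coeff (p i) j = 0)"
    "\<And>i. i \<in> I \<Longrightarrow> (\<forall>x\<in>S. f i x = poly (p i) (of_int x) * u x)"
    using assms unfolding poly_space_def mem_Collect_eq by metis
  show ?thesis
    unfolding poly_space_def mem_Collect_eq
    by (rule exI[of _ "\<Sum>i\<in>I. p i"]) (simp add: p coeff_sum poly_sum sum_distrib_right)
qed

lemma poly_space_mult: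
  assumes "f \<in> poly_space S u k" "degree t \<le> r"
  shows "(\<lambda>x. poly t (of_int x) * f x) \<in> poly_space S u (k + r)"
proof -
  obtain p where p: "\<forall>i\<ge>k. coeff p i = 0" "\<forall>x\<in>S. f x = poly p (of_int x) * u x"
    using assms by (auto simp: poly_space_def)
  have "coeff (t * p) i = 0" if "i \<ge> k + r" for i
  proof (cases "p = 0")
    case False
    then have "degree p < k"
      using p(1) by (metis leading_coeff_0_iff not_le)
    then have "degree (t * p) < i"
      using degree_mult_le[of t p] assms(2) that by linarith
    then show ?thesis by (rule coeff_eq_0)
  qed simp
  then show ?thesis
    using p(2) unfolding poly_space_def by (auto intro!: exI[of _ "t * p"])
qed

lemma poly_space_power_weight:
  "poly_space S (\<lambda>x. of_int x ^ d * u x) k \<subseteq> poly_space S u (k + d)"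
proof
  fix f assume "f \<in> poly_space S (\<lambda>x. of_int x ^ d * u x) k"
  then obtain p where p: "\<forall>i\<ge>k. coeff p i = 0"
    "\<forall>x\<in>S. f x = poly p (of_int x) * (of_int x ^ d * u x)"
    by (auto simp: poly_space_def)
  then show "f \<in> poly_space S u (k + d)"
    unfolding poly_space_def
    by (auto intro!: exI[of _ "monom 1 d * p"] simp: poly_monom coeff_monom_mult)
qed

lemma power_mult_in_poly_space:
  "f \<in> poly_space S u k \<Longrightarrow> (\<lambda>x. of_int x ^ d * f x) \<in> poly_space S (\<lambda>x. of_int x ^ d * u x) k"
  by (auto simp: poly_space_def) 

lemma poly_space_reflect:
  assumes f: "f \<in> poly_space S u k"
    and S: "\<And>x. x \<in> S \<Longrightarrow> - x \<in> S" and u: "\<And>x. x \<in> S \<Longrightarrow> u (- x) = s * u x"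
  shows "(\<lambda>x. f (- x)) \<in> poly_space S u k"
proof -
  obtain p where p: "\<forall>i\<ge>k. coeff p i = 0" "\<forall>x\<in>S. f x = poly p (of_int x) * u x"
    using f by (auto simp: poly_space_def)
  show ?thesis
    unfolding poly_space_def mem_Collect_eq
    by (rule exI[of _ "smult s (pcompose p [:0, -1:])"])
       (simp add: p S u coeff_pcompose_linear poly_pcompose)
qed

section \<open>Orthonormal systems and their kernels\<close>

text \<open>The factor \<open>u\<close> is a square root of the weight. A weight that vanishes at a point of \<open>S\<close> is
  covered by \<open>u\<close> vanishing there, which is how \<open>x\<^sup>2\<^sup>d w(x)\<close> enters, with \<open>x\<^sup>d \<surd>w(x)\<close> for \<open>u\<close>.\<close>

locale orthonormal_polynomials =
  fixes S :: "int set" and u :: "int \<Rightarrow> real" and M :: nat and p :: "nat \<Rightarrow> int \<Rightarrow> real"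
  assumes finite_S: "finite S"
    and exact_degree: "i < M \<Longrightarrow> \<exists>E. degree E = i \<and> E \<noteq> 0 \<and> (\<forall>x\<in>S. p i x = poly E (of_int x) * u x)"
    and orthonormal: "i < M \<Longrightarrow> j < M \<Longrightarrow> dot S (p i) (p j) = (if i = j then 1 else 0)"
begin

lemma in_space: "i < M \<Longrightarrow> i < k \<Longrightarrow> p i \<in> poly_space S u k"
  using exact_degree[of i] unfolding poly_space_def mem_Collect_eq by (metis coeff_eq_0 less_le_trans)

lemma kernel_in_space: "k \<le> M \<Longrightarrow> sum_kernel p k x \<in> poly_space S u k"
  unfolding sum_kernel_def by (intro poly_space_sum poly_space_scale in_space) auto

lemma span:
  assumes "k \<le> M" "f \<in> poly_space S u k"
  shows "\<exists>c. \<forall>x\<in>S. f x = (\<Sum>i<k. c i * p i x)"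
  using assms
proof (induction k arbitrary: f)
  case 0
  then show ?case by (auto simp: poly_space_def poly_eq_iff[of _ 0, simplified, symmetric])
next
  case (Suc k)
  obtain E where E: "degree E = k" "E \<noteq> 0" "\<forall>x\<in>S. p k x = poly E (of_int x) * u x"
    using exact_degree[of k] Suc.prems by auto
  obtain r where r: "\<forall>i\<ge>Suc k. coeff r i = 0" "\<forall>x\<in>S. f x = poly r (of_int x) * u x"
    using Suc.prems by (auto simp: poly_space_def)
  define a where "a = coeff r k / coeff E k"
  have "coeff E k \<noteq> 0" using E by auto
  then have "coeff (r - smult a E) i = 0" if "i \<ge> k" for i
    using that r(1) E(1) by (cases "i = k") (auto simp: a_def coeff_eq_0)
  then have "(\<lambda>x. f x - a * p k x) \<in> poly_space S u k"
    unfolding poly_space_def using r(2) E(3)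
    by (auto intro!: exI[of _ "r - smult a E"] simp: algebra_simps)
  then obtain c where c: "\<forall>x\<in>S. f x - a * p k x = (\<Sum>i<k. c i * p i x)"
    using Suc.IH[of "\<lambda>x. f x - a * p k x"] Suc.prems(1) by auto
  have "\<forall>x\<in>S. f x = (\<Sum>i<Suc k. (c(k := a)) i * p i x)"
    using c by (simp add: algebra_simps)
  then show ?case by blast
qed

lemma Fourier_expansion:
  assumes "k \<le> M" "f \<in> poly_space S u k" "x \<in> S"
  shows "f x = (\<Sum>i<k. dot S f (p i) * p i x)"
proof -
  obtain c where c: "\<forall>x\<in>S. f x = (\<Sum>i<k. c i * p i x)"
    using span assms by blast
  have "dot S f (p j) = c j" if "j < k" for j
  proof -
    have "dot S f (p j) = dot S (\<lambda>x. \<Sum>i<k. c i * p i x) (p j)"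
      by (rule dot_cong) (use c in auto)
    also have "\<dots> = (\<Sum>i<k. if i = j then c i else 0)"
      unfolding dot_sum_left using that assms(1) by (intro sum.cong) (auto simp: orthonormal)
    also have "\<dots> = c j"
      using that by simp
    finally show ?thesis .
  qed
  then show ?thesis using c assms(3) by simp
qed

lemma kernel_reproduces:
  assumes "k \<le> M" "f \<in> poly_space S u k" "x \<in> S"
  shows "dot S (sum_kernel p k x) f = f x"
  using Fourier_expansion[OF assms] unfolding sum_kernel_def dot_sum_left
  by (simp add: dot_commute mult.commute)

lemma orthogonal_to_lower:
  assumes "\<And>i. i < k \<Longrightarrow> dot S h (p i) = 0" "k \<le> M" "f \<in> poly_space S u k"
  shows "dot S h f = 0"
proof -
  have "dot S h f = dot S (\<lambda>x. \<Sum>i<k. dot S f (p i) * p i x) h"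
    unfolding dot_commute[of S h] by (rule dot_cong) (use Fourier_expansion assms in auto)
  also have "\<dots> = 0"
    unfolding dot_sum_left using assms(1) by (simp add: dot_commute)
  finally show ?thesis .
qed

text \<open>Only the coefficients with \<open>m \<le> i < l\<close> survive in the expansion of \<open>h\<close>, and by Parseval their
  squares sum to \<open>\<parallel>h\<parallel>\<^sup>2\<close>.\<close>

lemma tail_bound:
  assumes "l \<le> M" "h \<in> poly_space S u l" "z \<in> S" "m \<le> l"
    and orth: "\<And>i. i < m \<Longrightarrow> dot S h (p i) = 0"
  shows "(h z)\<^sup>2 \<le> dot S h h * (\<Sum>i\<in>{m..<l}. (p i z)\<^sup>2)"
proof -
  have split: "(\<Sum>i<l. dot S h (p i) * g i) = (\<Sum>i\<in>{m..<l}. dot S h (p i) * g i)" for g :: "nat \<Rightarrow> real"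
    by (rule sum.mono_neutral_right) (use orth in auto)
  have "dot S h h = dot S (\<lambda>x. \<Sum>i<l. dot S h (p i) * p i x) h"
    by (rule dot_cong) (use Fourier_expansion assms in auto)
  also have "\<dots> = (\<Sum>i\<in>{m..<l}. (dot S h (p i))\<^sup>2)"
    unfolding dot_sum_left by (simp add: dot_commute[of S _ h] split power2_eq_square)
  finally have norm: "dot S h h = (\<Sum>i\<in>{m..<l}. (dot S h (p i))\<^sup>2)" .
  have "h z = (\<Sum>i\<in>{m..<l}. dot S h (p i) * p i z)"
    using Fourier_expansion[OF assms(1-3)] by (simp add: split)
  then show ?thesis
    unfolding norm by (simp only: Cauchy_Schwarz_ineq_sum)
qed

text \<open>This plays the part of the Christoffel--Darboux formula: as a function of \<open>z\<close>, the product
  \<open>(x - z) K\<^sub>k(x, z)\<close> is a combination of \<open>p\<^sub>k\<^sub>-\<^sub>1\<close> and \<open>p\<^sub>k\<close> only. Bounding its norm replaces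
  knowledge of the recurrence coefficients.\<close>

lemma kernel_off_diagonal_bound:
  assumes k: "0 < k" "k < M" and x: "x \<in> S" and z: "z \<in> S"
    and C: "\<And>y. y \<in> S \<Longrightarrow> \<bar>of_int y\<bar> \<le> C"
  shows "((of_int x - of_int z) * sum_kernel p k x z)\<^sup>2
    \<le> (2 * C)\<^sup>2 * sum_kernel p k x x * (\<Sum>i\<in>{k - 1..<k + 1}. (p i z)\<^sup>2)"
proof -
  define t where "t = [:real_of_int x, - 1:]"
  have t: "poly t (of_int y) = of_int x - of_int y" for y
    by (simp add: t_def)
  define h where "h = (\<lambda>y. poly t (of_int y) * sum_kernel p k x y)"
  have K: "sum_kernel p k x \<in> poly_space S u k"
    using k kernel_in_space by simp
  have h: "h \<in> poly_space S u (k + 1)"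
    unfolding h_def by (rule poly_space_mult[OF K]) (simp add: t_def)
  have "dot S h (p i) = 0" if i: "i < k - 1" for i
  proof -
    have "p i \<in> poly_space S u (k - 1)"
      using i k by (intro in_space) auto
    from poly_space_mult[OF this, of t 1]
    have "(\<lambda>y. poly t (of_int y) * p i y) \<in> poly_space S u k"
      using k by (simp add: t_def)
    \<comment> \<open>The reproduced function carries the factor \<open>x - y\<close>, which is zero at \<open>y = x\<close>.\<close>
    from kernel_reproduces[OF _ this x] show ?thesis
      unfolding h_def dot_mult_left using k by (simp add: t)
  qed
  then have "(h z)\<^sup>2 \<le> dot S h h * (\<Sum>i\<in>{k - 1..<k + 1}. (p i z)\<^sup>2)"
    using k h z by (intro tail_bound) auto
  also have "\<dots> \<le> ((2 * C)\<^sup>2 * sum_kernel p k x x) * (\<Sum>i\<in>{k - 1..<k + 1}. (p i z)\<^sup>2)"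
  proof (rule mult_right_mono)
    have t_le: "\<bar>poly t (of_int y)\<bar> \<le> 2 * C" if "y \<in> S" for y
      using C[OF that] C[OF x] by (simp add: t)
    have "dot S h h \<le> (2 * C)\<^sup>2 * dot S (sum_kernel p k x) (sum_kernel p k x)"
      unfolding h_def by (rule dot_mult_self_le) (rule t_le)
    then show "dot S h h \<le> (2 * C)\<^sup>2 * sum_kernel p k x x"
      using kernel_reproduces[OF _ K x] k by simp
  qed (simp add: sum_nonneg)
  finally show ?thesis
    by (simp add: h_def t)
qed

text \<open>The leading terms cancel in \<open>g(x) = p\<^sub>i(-x) - s (-1)\<^sup>i p\<^sub>i(x)\<close>, so \<open>g\<close> lies in the space spanned by
  the lower \<open>p\<^sub>j\<close>. That space is invariant under reflection, so both terms of \<open>g\<close> are orthogonal to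
  it. Hence \<open>g\<close> is orthogonal to itself and vanishes.\<close>

lemma parity:
  assumes S: "\<And>x. x \<in> S \<Longrightarrow> - x \<in> S" and u: "\<And>x. x \<in> S \<Longrightarrow> u (- x) = s * u x"
    and i: "i < M" and x: "x \<in> S"
  shows "p i (- x) = s * (- 1) ^ i * p i x"
proof -
  obtain E where E: "degree E = i" "E \<noteq> 0" "\<forall>x\<in>S. p i x = poly E (of_int x) * u x"
    using exact_degree i by auto
  define g where "g = (\<lambda>x. p i (- x) - s * (- 1) ^ i * p i x)"
  define r where "r = smult s (pcompose E [:0, -1:] - smult ((- 1) ^ i) E)"
  have "coeff r j = 0" if "j \<ge> i" for j
    using that E(1) by (cases "j = i") (auto simp: r_def coeff_pcompose_linear coeff_eq_0)
  then have g: "g \<in> poly_space S u i"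
    unfolding poly_space_def mem_Collect_eq
    by (intro exI[of _ r]) (auto simp: g_def r_def E S u poly_pcompose algebra_simps)
  have "dot S (p i) f = 0" if "f \<in> poly_space S u i" for f
    by (rule orthogonal_to_lower[OF _ _ that]) (use i in \<open>auto simp: orthonormal\<close>)
  moreover have "dot S (\<lambda>x. p i (- x)) g = dot S (p i) (\<lambda>x. g (- x))"
    unfolding dot_def by (rule sum.reindex_bij_witness[of _ uminus uminus]) (auto simp: S)
  ultimately have "dot S g g = 0"
    using poly_space_reflect[OF g S u] g
    by (subst (1) g_def) (simp add: dot_diff_left dot_scale_left[of S "s * (- 1) ^ i"])
  then have "g x = 0"
    using dot_self_eq_0D finite_S x by blast
  then show ?thesis by (simp add: g_def)
qed

text \<open>The difference \<open>R\<close> of the two kernels represents evaluation at \<open>x\<close> on the larger space minus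
  evaluation at \<open>x\<close> on the smaller one, so it annihilates the smaller space and
  \<open>\<parallel>R\<parallel>\<^sup>2 = R(x) \<le> K(x, x)\<close>. Multiplication by \<open>y\<^sup>d\<close> maps the polynomials of degree less than \<open>k\<close> into the
  smaller space, which moves the orthogonality to \<open>y\<^sup>d R(y)\<close> and leaves it only \<open>2d\<close> coefficients.\<close>

lemma deformed_kernel_bound:
  assumes q: "orthonormal_polynomials S (\<lambda>x. of_int x ^ d * u x) M' q"
    and k: "k \<le> M'" "k + 2 * d \<le> M" and x: "x \<in> S" and z: "z \<in> S"
    and C: "\<And>y. y \<in> S \<Longrightarrow> \<bar>of_int y\<bar> \<le> C"
  shows "(of_int z ^ d * (sum_kernel p (k + d) x z - sum_kernel q k x z))\<^sup>2
    \<le> (C ^ d)\<^sup>2 * sum_kernel p (k + d) x x * (\<Sum>i\<in>{k..<k + 2 * d}. (p i z)\<^sup>2)"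
proof -
  interpret q: orthonormal_polynomials S "\<lambda>x. of_int x ^ d * u x" M' q
    by (rule q)
  define R where "R = (\<lambda>y. sum_kernel p (k + d) x y - sum_kernel q k x y)"
  define h where "h = (\<lambda>y. of_int y ^ d * R y)"
  have qK: "sum_kernel q k x \<in> poly_space S (\<lambda>x. of_int x ^ d * u x) k"
    using k q.kernel_in_space by simp
  have R: "R \<in> poly_space S u (k + d)"
    unfolding R_def using k qK poly_space_power_weight[of S d u k]
    by (intro poly_space_diff kernel_in_space) auto
  have R_orth: "dot S R f = 0" if f: "f \<in> poly_space S (\<lambda>x. of_int x ^ d * u x) k" for f
  proof -
    have "f \<in> poly_space S u (k + d)"
      using f poly_space_power_weight by blast
    then show ?thesis
      unfolding R_def dot_diff_left using k f x kernel_reproduces q.kernel_reproduces by simp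
  qed
  have "dot S R R = dot S (sum_kernel p (k + d) x) R - dot S (sum_kernel q k x) R"
    by (subst (1) R_def) (rule dot_diff_left)
  also have "\<dots> = R x"
    using R_orth[OF qK] kernel_reproduces[OF _ R x] k by (simp add: dot_commute[of S _ R])
  also have "\<dots> \<le> sum_kernel p (k + d) x x"
    by (simp add: R_def sum_kernel_def sum_nonneg)
  finally have RR: "dot S R R \<le> sum_kernel p (k + d) x x" .
  have "h \<in> poly_space S u (k + d + d)"
    unfolding h_def using poly_space_mult[OF R, of "monom 1 d" d]
    by (simp add: poly_monom degree_monom_eq)
  moreover have "dot S h (p i) = 0" if "i < k" for i
    unfolding h_def dot_mult_left
    by (intro R_orth power_mult_in_poly_space in_space) (use that k in auto)
  ultimately have "(h z)\<^sup>2 \<le> dot S h h * (\<Sum>i\<in>{k..<k + 2 * d}. (p i z)\<^sup>2)"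
    using k z by (intro tail_bound) (auto simp: mult_2 add.assoc)
  also have "\<dots> \<le> ((C ^ d)\<^sup>2 * sum_kernel p (k + d) x x) * (\<Sum>i\<in>{k..<k + 2 * d}. (p i z)\<^sup>2)"
  proof (rule mult_right_mono)
    have "dot S h h \<le> (C ^ d)\<^sup>2 * dot S R R"
      unfolding h_def by (rule dot_mult_self_le) (simp add: power_abs power_mono C)
    then show "dot S h h \<le> (C ^ d)\<^sup>2 * sum_kernel p (k + d) x x"
      using mult_left_mono[OF RR, of "(C ^ d)\<^sup>2"] by simp
  qed (simp add: sum_nonneg)
  finally show ?thesis
    by (simp add: h_def R_def)
qed

text \<open>Adding the reflected kernel with the sign \<open>s\<close> doubles the terms of even index and cancels those
  of odd index, by parity.\<close>

lemma even_index_kernel: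
  assumes S: "\<And>x. x \<in> S \<Longrightarrow> - x \<in> S" and u: "\<And>x. x \<in> S \<Longrightarrow> u (- x) = s * u x"
    and s: "s * s = 1" and n: "2 * n \<le> M" and y: "y \<in> S"
  shows "2 * (\<Sum>l<n. p (2 * l) x * p (2 * l) y) = sum_kernel p (2 * n) x y + s * sum_kernel p (2 * n) x (- y)"
  using n
proof (induction n)
  case (Suc n)
  have "p (2 * n) (- y) = s * p (2 * n) y" "p (Suc (2 * n)) (- y) = - s * p (Suc (2 * n)) y"
    using parity[OF S u _ y] Suc.prems by auto
  then have "s * p (2 * n) (- y) = p (2 * n) y" "s * p (Suc (2 * n)) (- y) = - p (Suc (2 * n)) y"
    using s by (simp_all flip: mult.assoc)
  then have "s * (p (2 * n) x * p (2 * n) (- y)) = p (2 * n) x * p (2 * n) y"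
    "s * (p (Suc (2 * n)) x * p (Suc (2 * n)) (- y)) = - p (Suc (2 * n)) x * p (Suc (2 * n)) y"
    by (simp_all add: mult.left_commute[of s])
  moreover have "sum_kernel p (2 * Suc n) x z
      = sum_kernel p (2 * n) x z + p (2 * n) x * p (2 * n) z + p (Suc (2 * n)) x * p (Suc (2 * n)) z" for z
    by (simp add: sum_kernel_def)
  moreover have "2 * (\<Sum>l<n. p (2 * l) x * p (2 * l) y)
      = sum_kernel p (2 * n) x y + s * sum_kernel p (2 * n) x (- y)"
    using Suc by simp
  ultimately show ?case
    unfolding sum.lessThan_Suc by (simp only: distrib_left)
qed (simp add: sum_kernel_def)

end

section \<open>Monic orthogonal polynomials on the grid\<close>

lemma grid_uminus: "x \<in> grid N \<Longrightarrow> - x \<in> grid N"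
  by (auto simp: grid_def)

lemma grid_abs_le: "x \<in> grid N \<Longrightarrow> \<bar>real_of_int x\<bar> \<le> real N"
  by (auto simp: grid_def abs_le_iff)

lemma monic_orthogonal_mono:
  assumes "monic_orthogonal N W M P" "M' \<le> M"
  shows "monic_orthogonal N W M' P"
  using assms unfolding monic_orthogonal_def by (meson less_le_trans)

text \<open>The bound on \<open>M\<close> makes all norms positive: a nonzero polynomial of degree less than \<open>M\<close> cannot
  vanish at all points that carry weight. The case \<open>e = 0\<close> is the original system.\<close>

lemma deformed_ortho_fun_orthonormal:
  assumes w: "even_positive_weight N w"
    and Q: "monic_orthogonal N (deformed_weight w e) M Q"
    and M: "M \<le> card {x \<in> grid N. deformed_weight w e x \<noteq> 0}"
  shows "orthonormal_polynomials (grid N) (\<lambda>x. of_int x ^ e * sqrt (w x)) M (deformed_ortho_fun N w e Q)"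
proof
  let ?W = "deformed_weight w e" and ?u = "\<lambda>x. of_int x ^ e * sqrt (w x)"
  show "finite (grid N)" by (simp add: grid_def)
  have w0: "w x > 0" if "x \<in> grid N" for x
    using w that by (simp add: even_positive_weight_def)
  then have W0: "?W x \<ge> 0" if "x \<in> grid N" for x
    using that by (simp add: deformed_weight_def less_imp_le)
  have u2: "?u x * ?u x = ?W x" if "x \<in> grid N" for x
    using w0[OF that] by (simp add: deformed_weight_def power_mult power2_eq_square mult_ac flip: power_mult_distrib)
  have norm_pos: "wnorm N ?W (Q i) > 0" if i: "i < M" for i
  proof -
    have "degree (Q i) = i" "Q i \<noteq> 0"
      using Q i by (auto simp: monic_orthogonal_def)
    let ?Z = "{x \<in> grid N. ?W x \<noteq> 0}"
    have "\<exists>x\<in>?Z. poly (Q i) (of_int x) \<noteq> 0"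
    proof (rule ccontr)
      assume "\<not> ?thesis"
      then have "of_int ` ?Z \<subseteq> {x. poly (Q i) x = 0}" by auto
      then have "card (real_of_int ` ?Z) \<le> card {x. poly (Q i) x = 0}"
        by (intro card_mono poly_roots_finite \<open>Q i \<noteq> 0\<close>)
      also have "\<dots> \<le> i"
        using card_poly_roots_bound[OF \<open>Q i \<noteq> 0\<close>] \<open>degree (Q i) = i\<close> by simp
      finally show False
        using M i by (simp add: card_image inj_on_def)
    qed
    then obtain x where "x \<in> grid N" "?W x \<noteq> 0" "poly (Q i) (of_int x) \<noteq> 0" by auto
    then have "0 < (\<Sum>x\<in>grid N. (poly (Q i) (of_int x))\<^sup>2 * ?W x)"
      using W0 by (intro sum_pos2[of _ x]) (auto simp: \<open>finite (grid N)\<close> less_le)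
    then show ?thesis by (simp add: wnorm_def)
  qed
  show "\<exists>E. degree E = i \<and> E \<noteq> 0 \<and>
      (\<forall>x\<in>grid N. deformed_ortho_fun N w e Q i x = poly E (of_int x) * ?u x)" if i: "i < M" for i
    using Q i norm_pos[OF i]
    by (intro exI[of _ "smult (1 / wnorm N ?W (Q i)) (Q i)"])
       (auto simp: deformed_ortho_fun_def monic_orthogonal_def)
  show "dot (grid N) (deformed_ortho_fun N w e Q i) (deformed_ortho_fun N w e Q j)
      = (if i = j then 1 else 0)" if ij: "i < M" "j < M" for i j
  proof -
    let ?c = "1 / (wnorm N ?W (Q i) * wnorm N ?W (Q j))"
    have "dot (grid N) (deformed_ortho_fun N w e Q i) (deformed_ortho_fun N w e Q j)
        = ?c * winner N ?W (Q i) (Q j)"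
      unfolding dot_def winner_def sum_distrib_left
    proof (rule sum.cong)
      fix x assume "x \<in> grid N"
      have "deformed_ortho_fun N w e Q i x * deformed_ortho_fun N w e Q j x
        = ?c * (poly (Q i) (of_int x) * poly (Q j) (of_int x) * (?u x * ?u x))"
        by (simp add: deformed_ortho_fun_def)
      then show "deformed_ortho_fun N w e Q i x * deformed_ortho_fun N w e Q j x
        = ?c * (poly (Q i) (of_int x) * poly (Q j) (of_int x) * ?W x)"
        using u2[OF \<open>x \<in> grid N\<close>] by simp
    qed simp
    also have "\<dots> = (if i = j then 1 else 0)"
    proof (cases "i = j")
      case True
      have "winner N ?W (Q i) (Q i) = (wnorm N ?W (Q i))\<^sup>2"
        using W0 by (simp add: winner_def wnorm_def sum_nonneg power2_eq_square)
      then show ?thesis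
        using True norm_pos[OF ij(1)] by (simp add: power2_eq_square)
    qed (use Q ij in \<open>simp add: monic_orthogonal_def\<close>)
    finally show ?thesis .
  qed
qed

lemma sqrt_weight_reflect:
  assumes "even_positive_weight N w" "x \<in> grid N"
  shows "of_int (- x) ^ d * sqrt (w (- x)) = (- 1) ^ d * (of_int x ^ d * sqrt (w x))"
  using assms by (simp add: even_positive_weight_def power_minus[of "of_int x"])

section \<open>The limit of the even kernel\<close>

text \<open>This is the form in which the bounds on kernels are used: \<open>a\<close> is the factor \<open>x + y\<close> or
  \<open>(\<plusminus>y)\<^sup>d\<close>, \<open>b\<close> its bound on the grid, \<open>F\<close> a diagonal value of the kernel and \<open>T\<close> the sum over the few
  remaining indices. Both kernel values on the right absorb one factor \<open>D\<close>.\<close>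

lemma tendsto_0_from_square_bound:
  fixes a b D F G T :: "nat \<Rightarrow> real"
  assumes bound: "\<forall>\<^sub>F N in sequentially. (a N * G N)\<^sup>2 \<le> (b N)\<^sup>2 * F N * T N"
    and a: "\<forall>\<^sub>F N in sequentially. a N \<noteq> 0"
    and ratio: "(\<lambda>N. b N / a N) \<longlonglongrightarrow> c"
    and F: "(\<lambda>N. D N * F N) \<longlonglongrightarrow> k"
    and T: "(\<lambda>N. D N * T N) \<longlonglongrightarrow> 0"
  shows "(\<lambda>N. D N * G N) \<longlonglongrightarrow> 0"
proof -
  let ?B = "\<lambda>N. (b N / a N)\<^sup>2 * (D N * F N) * (D N * T N)"
  have "?B \<longlonglongrightarrow> c\<^sup>2 * k * 0"
    by (intro tendsto_intros ratio F T)
  then have lim: "(\<lambda>N. sqrt (?B N)) \<longlonglongrightarrow> 0"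
    using tendsto_real_sqrt by fastforce
  have "\<forall>\<^sub>F N in sequentially. norm (D N * G N) \<le> sqrt (?B N)"
    using bound a
  proof eventually_elim
    case (elim N)
    have "(D N * G N)\<^sup>2 = (D N / a N)\<^sup>2 * (a N * G N)\<^sup>2"
      using elim by (simp add: power2_eq_square)
    also have "\<dots> \<le> (D N / a N)\<^sup>2 * ((b N)\<^sup>2 * F N * T N)"
      using elim by (intro mult_left_mono) auto
    also have "\<dots> = ?B N"
      by (simp add: power2_eq_square)
    finally show ?case
      using real_sqrt_le_mono[of "(D N * G N)\<^sup>2"] by simp
  qed
  then show ?thesis
    by (intro tendsto_0_le[OF lim, of _ 1]) (auto elim!: eventually_mono)
qed

theorem proposition3p5:
  fixes w :: "nat \<Rightarrow> int \<Rightarrow> real"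
    and P :: "nat \<Rightarrow> nat \<Rightarrow> real poly"
    and Q :: "nat \<Rightarrow> nat \<Rightarrow> nat \<Rightarrow> real poly"
    and n :: "nat \<Rightarrow> nat"
    and v :: real
    and X :: "real set"
    and D :: "nat \<Rightarrow> real"
    and \<xi> :: "nat \<Rightarrow> real \<Rightarrow> int"
    and Klim :: "real \<Rightarrow> real \<Rightarrow> real"
    and d :: nat
    and A B :: real
  assumes weight: "\<And>N. even_positive_weight N (w N)"
    and P: "\<And>N. monic_orthogonal N (w N) (2 * N + 1) (P N)"
    and Q: "\<And>N e. e \<ge> 1 \<Longrightarrow> monic_orthogonal N (deformed_weight (w N) e) (2 * N) (Q N e)"
    and n_pos: "\<And>N. n N > 0"
    and n_lim: "filterlim n at_top sequentially"
    and Nn_lim: "filterlim (\<lambda>N. int N - int (n N)) at_top sequentially"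
    and v: "v \<in> {-1..1} - {0}"
    and X: "X \<in> {\<int>, {a \<in> \<int>. a \<ge> 0}, {a \<in> \<int>. a \<le> 0}, UNIV}"
    and D_pos: "\<And>N. D N > 0"
    and \<xi>_grid: "\<And>N a. a \<in> X \<Longrightarrow> \<xi> N a \<in> grid N"
    and \<xi>_lim: "\<And>a. a \<in> X \<Longrightarrow> (\<lambda>N. real_of_int (\<xi> N a) / real N) \<longlonglongrightarrow> v"
    and K_lim: "\<And>(j::int) a b. a \<in> X \<Longrightarrow> b \<in> X \<Longrightarrow>
      (\<lambda>N. D N * CD_kernel N (w N) (P N) (nat (2 * int (n N) + j)) (\<xi> N a) (\<xi> N b))
        \<longlonglongrightarrow> Klim a b"
    and A: "A \<in> X" and B: "B \<in> X"
  shows "(\<lambda>N. D N * even_kernel N (w N) (P N) (Q N) d (n N) (\<xi> N A) (\<xi> N B)) \<longlonglongrightarrow> Klim A B"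
proof -
  define u where "u N x = sqrt (w N x)" for N x
  define p where "p N = ortho_fun N (w N) (P N)" for N
  \<comment> \<open>For \<open>d = 0\<close> the family \<open>P\<close> serves as the deformed one, so all \<open>d\<close> are treated alike.\<close>
  define q where "q N = deformed_ortho_fun N (w N) d (if d = 0 then P N else Q N d)" for N
  define x where "x N = \<xi> N A" for N
  define y where "y N = \<xi> N B" for N
  define K where "K N = sum_kernel (p N) (2 * n N + d)" for N
  define L where "L N = sum_kernel (q N) (2 * n N)" for N
  \<comment> \<open>One window of indices, wide enough for both bounds: \<open>kernel_off_diagonal_bound\<close> uses
    \<open>2n + d - 1\<close> and \<open>2n + d\<close>, and \<open>deformed_kernel_bound\<close> uses \<open>2n, \<dots>, 2n + 2d - 1\<close>.\<close>
  define T where "T N z = (\<Sum>i\<in>{2 * n N - 1..<2 * n N + 2 * d + 1}. (p N i z)\<^sup>2)" for N z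
  have weight0: "deformed_weight (w N) 0 = w N" for N
    by (simp add: deformed_weight_def fun_eq_iff)
  have card0: "card {x \<in> grid N. deformed_weight (w N) e x \<noteq> 0} \<ge> 2 * N + (if e = 0 then 1 else 0)" for N e
  proof -
    have "w N x \<noteq> 0" if "x \<in> grid N" for x
      using weight[of N] that by (force simp: even_positive_weight_def)
    then have "{x \<in> grid N. deformed_weight (w N) e x \<noteq> 0} = (if e = 0 then grid N else grid N - {0})"
      by (auto simp: deformed_weight_def)
    moreover have "card (grid N) = 2 * N + 1" "0 \<in> grid N"
      by (auto simp: grid_def)
    ultimately show ?thesis by simp
  qed
  have p_eq: "p N = deformed_ortho_fun N (w N) 0 (P N)" for N
    by (simp add: p_def ortho_fun_def deformed_ortho_fun_def weight0 fun_eq_iff)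
  have p_ortho: "orthonormal_polynomials (grid N) (u N) (2 * N + 1) (p N)" for N
    using deformed_ortho_fun_orthonormal[of N "w N" 0 "2 * N + 1" "P N"] weight P card0[of N 0]
    by (simp add: p_eq weight0 u_def[abs_def])
  have q_ortho: "orthonormal_polynomials (grid N) (\<lambda>x. of_int x ^ d * u N x) (2 * N) (q N)" for N
  proof -
    have "monic_orthogonal N (deformed_weight (w N) d) (2 * N) (if d = 0 then P N else Q N d)"
      using monic_orthogonal_mono[OF P[of N], of "2 * N"] Q[of d N] weight0 by (cases "d = 0") auto
    then show ?thesis
      unfolding q_def u_def using card0[of N d] weight
      by (intro deformed_ortho_fun_orthonormal) (auto split: if_splits)
  qed
  have u_even: "u N (- z) = 1 * u N z" if "z \<in> grid N" for N z
    using sqrt_weight_reflect[OF weight that, of 0] by (simp add: u_def)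
  have du_parity: "of_int (- z) ^ d * u N (- z) = (- 1) ^ d * (of_int z ^ d * u N z)" if "z \<in> grid N" for N z
    using sqrt_weight_reflect[OF weight that, of d] by (simp add: u_def)
  have xg: "x N \<in> grid N" and yg: "y N \<in> grid N" for N
    using \<xi>_grid A B by (auto simp: x_def y_def)
  have x_lim: "(\<lambda>N. x N / N) \<longlonglongrightarrow> v" and y_lim: "(\<lambda>N. y N / N) \<longlonglongrightarrow> v"
    using \<xi>_lim A B by (auto simp: x_def y_def)
  have v0: "v \<noteq> 0" using v by simp
  have x_nz: "\<forall>\<^sub>F N in sequentially. x N \<noteq> 0"
    using tendsto_imp_eventually_ne[OF x_lim v0] by eventually_elim auto
  have y_nz: "\<forall>\<^sub>F N in sequentially. y N \<noteq> 0"
    using tendsto_imp_eventually_ne[OF y_lim v0] by eventually_elim auto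
  have s_lim: "(\<lambda>N. x N / N + y N / N) \<longlonglongrightarrow> 2 * v"
    using tendsto_add[OF x_lim y_lim] by simp
  have s_nz: "\<forall>\<^sub>F N in sequentially. real_of_int (x N) + y N \<noteq> 0"
    using tendsto_imp_eventually_ne[OF s_lim] v0 by (force elim: eventually_mono simp flip: add_divide_distrib)
  \<comment> \<open>All indices in the window must be below \<open>2N + 1\<close>.\<close>
  have room: "\<forall>\<^sub>F N in sequentially. n N + d + 1 \<le> N"
    using Nn_lim[unfolded filterlim_at_top, rule_format, of "int d + 1"] by eventually_elim simp
  have CD: "CD_kernel N (w N) (P N) k = sum_kernel (p N) k" for N k
    by (simp add: CD_kernel_def sum_kernel_def p_def fun_eq_iff)
  have shift: "(\<lambda>N. D N * sum_kernel (p N) (2 * n N + j) (\<xi> N a) (\<xi> N b)) \<longlonglongrightarrow> Klim a b"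
    if "a \<in> X" "b \<in> X" for a b j
    using K_lim[OF that, of "int j"] by (simp add: CD nat_add_distrib nat_mult_distrib)
  have K_xy: "(\<lambda>N. D N * K N (x N) (y N)) \<longlonglongrightarrow> Klim A B"
    and K_xx: "(\<lambda>N. D N * K N (x N) (x N)) \<longlonglongrightarrow> Klim A A"
    using shift[of _ _ d] A B by (auto simp: K_def x_def y_def)
  have T_lim: "(\<lambda>N. D N * T N (y N)) \<longlonglongrightarrow> 0"
  proof -
    have pred: "nat (2 * int (n N) - 1) = 2 * n N - 1" for N by simp
    \<comment> \<open>The window sum is a difference of two diagonal kernels, both with the limit \<open>Klim B B\<close>.\<close>
    have T_eq: "T N z = sum_kernel (p N) (2 * n N + (2 * d + 1)) z z - sum_kernel (p N) (2 * n N - 1) z z" for N z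
      using sum_diff_nat_ivl[of 0 "2 * n N - 1" "2 * n N + (2 * d + 1)" "\<lambda>i. (p N i z)\<^sup>2"]
      by (simp add: T_def sum_kernel_def power2_eq_square lessThan_atLeast0)
    show ?thesis
      using tendsto_diff[OF shift[OF B B, of "2 * d + 1"] K_lim[OF B B, of "- 1"]]
      by (simp add: T_eq y_def CD pred right_diff_distrib)
  qed
  have T_reflect: "T N (- y N) = T N (y N)" if "n N + d + 1 \<le> N" for N
    unfolding T_def
  proof (rule sum.cong)
    fix i assume "i \<in> {2 * n N - 1..<2 * n N + 2 * d + 1}"
    then have "p N i (- y N) = 1 * (- 1) ^ i * p N i (y N)"
      using that by (intro orthonormal_polynomials.parity[OF p_ortho _ _ _ yg] grid_uminus u_even) auto
    then show "(p N i (- y N))\<^sup>2 = (p N i (y N))\<^sup>2"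
      by (cases "even i") simp_all
  qed simp
  have window: "(\<Sum>i\<in>{l..<m}. (p N i z)\<^sup>2) \<le> T N z" if "2 * n N - 1 \<le> l" "m \<le> 2 * n N + 2 * d + 1" for N l m z
    unfolding T_def by (rule sum_mono2) (use that in auto)
  have K_nonneg: "K N z z \<ge> 0" for N z
    by (simp add: K_def sum_kernel_def sum_nonneg)
  have K_reflected: "(\<lambda>N. D N * K N (x N) (- y N)) \<longlonglongrightarrow> 0"
  proof (rule tendsto_0_from_square_bound[OF _ s_nz _ K_xx T_lim])
    show "\<forall>\<^sub>F N in sequentially. ((real_of_int (x N) + y N) * K N (x N) (- y N))\<^sup>2
        \<le> (2 * real N)\<^sup>2 * K N (x N) (x N) * T N (y N)"
      using room
    proof eventually_elim
      case (elim N)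
      let ?k = "2 * n N + d"
      have "((of_int (x N) - of_int (- y N)) * sum_kernel (p N) ?k (x N) (- y N))\<^sup>2
        \<le> (2 * real N)\<^sup>2 * sum_kernel (p N) ?k (x N) (x N) * (\<Sum>i\<in>{?k - 1..<?k + 1}. (p N i (- y N))\<^sup>2)"
        using elim n_pos[of N]
        by (intro orthonormal_polynomials.kernel_off_diagonal_bound[OF p_ortho] xg grid_uminus yg grid_abs_le) auto
      also have "\<dots> \<le> (2 * real N)\<^sup>2 * sum_kernel (p N) ?k (x N) (x N) * T N (- y N)"
        using K_nonneg[of N "x N"] by (intro mult_left_mono window) (auto simp: K_def)
      finally show ?case
        using elim by (simp add: K_def T_reflect)
    qed
    have "(\<lambda>N. 2 / (x N / N + y N / N)) \<longlonglongrightarrow> 2 / (2 * v)"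
      by (intro tendsto_divide tendsto_const s_lim) (use v0 in simp)
    then show "(\<lambda>N. 2 * real N / (real_of_int (x N) + y N)) \<longlonglongrightarrow> 2 / (2 * v)"
      by (simp flip: add_divide_distrib)
  qed
  have deformation: "(\<lambda>N. D N * (K N (x N) (s * y N) - L N (x N) (s * y N))) \<longlonglongrightarrow> 0"
    if s: "s = 1 \<or> s = - 1" for s
  proof (rule tendsto_0_from_square_bound[OF _ _ _ K_xx T_lim])
    show "\<forall>\<^sub>F N in sequentially. (real_of_int (s * y N) ^ d * (K N (x N) (s * y N) - L N (x N) (s * y N)))\<^sup>2
        \<le> (real N ^ d)\<^sup>2 * K N (x N) (x N) * T N (y N)"
      using room
    proof eventually_elim
      case (elim N)
      let ?z = "s * y N"
      have z: "?z \<in> grid N"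
        using s yg grid_uminus by auto
      have "(of_int ?z ^ d * (K N (x N) ?z - L N (x N) ?z))\<^sup>2
        \<le> (real N ^ d)\<^sup>2 * K N (x N) (x N) * (\<Sum>i\<in>{2 * n N..<2 * n N + 2 * d}. (p N i ?z)\<^sup>2)"
        unfolding K_def L_def using elim
        by (intro orthonormal_polynomials.deformed_kernel_bound[OF p_ortho q_ortho] xg z grid_abs_le) auto
      also have "\<dots> \<le> (real N ^ d)\<^sup>2 * K N (x N) (x N) * T N ?z"
        using K_nonneg[of N "x N"] by (intro mult_left_mono window) auto
      finally show ?case
        using s elim T_reflect by auto
    qed
    show "\<forall>\<^sub>F N in sequentially. real_of_int (s * y N) ^ d \<noteq> 0"
      using y_nz by (rule eventually_mono) (use s in auto)
    have "(\<lambda>N. (1 / (s * (y N / N))) ^ d) \<longlonglongrightarrow> (1 / (s * v)) ^ d"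
      by (intro tendsto_intros y_lim) (use v0 s in auto)
    then show "(\<lambda>N. real N ^ d / real_of_int (s * y N) ^ d) \<longlonglongrightarrow> (1 / (s * v)) ^ d"
      by (simp add: power_divide)
  qed
  have even: "\<forall>\<^sub>F N in sequentially. D N * K N (x N) (y N) - D N * (K N (x N) (y N) - L N (x N) (y N))
      + (- 1) ^ d * (D N * K N (x N) (- y N) - D N * (K N (x N) (- y N) - L N (x N) (- y N)))
      = D N * even_kernel N (w N) (P N) (Q N) d (n N) (\<xi> N A) (\<xi> N B)"
    using room x_nz y_nz
  proof eventually_elim
    case (elim N)
    \<comment> \<open>Away from the origin \<open>eta\<close> is 1.\<close>
    have "even_kernel N (w N) (P N) (Q N) d (n N) (x N) (y N)
      = 2 * (\<Sum>l<n N. q N (2 * l) (x N) * q N (2 * l) (y N))"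
      using elim p_eq[of N] by (simp add: even_kernel_def eta_def q_def p_def[symmetric])
    also have "\<dots> = L N (x N) (y N) + (- 1) ^ d * L N (x N) (- y N)"
      unfolding L_def
      by (rule orthonormal_polynomials.even_index_kernel[OF q_ortho])
         (use elim yg in \<open>auto simp: grid_uminus du_parity[simplified] simp flip: power_mult_distrib\<close>)
    finally show ?case
      by (simp add: x_def y_def algebra_simps)
  qed
  have "(\<lambda>N. D N * K N (x N) (y N) - D N * (K N (x N) (y N) - L N (x N) (y N))
      + (- 1) ^ d * (D N * K N (x N) (- y N) - D N * (K N (x N) (- y N) - L N (x N) (- y N))))
      \<longlonglongrightarrow> Klim A B - 0 + (- 1) ^ d * (0 - 0)"
    using deformation[of 1] deformation[of "- 1"] by (intro tendsto_intros K_xy K_reflected) auto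
  then show ?thesis
    using Lim_transform_eventually[OF _ even] by simp
qed

end
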